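(* Let $m,n\in\mathbb{N}_{0}$ and let $a,b\in\mathbb{Z}$ with $a\equiv b\equiv 1 \pmod 2$. Then for all $x,y,z\in\mathbb{R}$, \begin{align*} &2b^{n}\,\mathrm{sgn}(b)\sum_{j=0}^{m}\binom{m}{j}\frac{(-1)^{j}a^{m-j}}{m+n+1-j}\,S_{j,m+n+1-j}^{(5)}\begin{pmatrix} a & 1 & b\\ y & x & z\end{pmatrix} +2a^{m}\,\mathrm{sgn}(a)\sum_{j=0}^{n}\binom{n}{j}\frac{(-1)^{j}b^{n-j}}{m+n+1-j}\,S_{j,m+n+1-j}^{(5)}\begin{pmatrix} b & 1 & a\\ z & x & y\end{pmatrix}\\ &=(-1)^{m+n}\overline{E}_{m}(ax-y)\overline{E}_{n}(bx-z) +\delta_{0,m}\delta_{0,n}\,\mathrm{sgn}(ab)\,(-1)^{ax+bx-y-z}\,\delta_{\mathbb{Z}}(ax-y)\,\delta_{\mathbb{Z}}(bx-z)\\ &\quad+\frac{(-1)^{m}\,2\,m!\,n!\,(a,b)^{m+n+2}}{a^{n+1}b^{m+1}(m+n+1)!}\,\overline{E}_{m+n+1}\!\left(\frac{az-by}{(a,b)}\right). \end{align*} (The factor $(-1)^{ax+bx-y-z}$ is only relevant when $ax-y,bx-z\in\mathbb{Z}$, in which case its exponent is an integer.)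
   Context: For real $x$, $[x]$ is the floor of $x$ and $\{x\}=x-[x]$. $E_n(x)$ denotes the Euler polynomial (generating function $\frac{2e^{xt}}{e^t+1}=\sum_{n\ge0}E_n(x)\frac{t^n}{n!}$) and $B_n(x)$ the Bernoulli polynomial ($\frac{te^{xt}}{e^t-1}=\sum_{n\ge0}B_n(x)\frac{t^n}{n!}$). Quasi-periodic Euler functions: $\overline{E}_{0}(x)=(-1)^{[x]}$ if $x\notin\mathbb{Z}$ and $\overline{E}_0(x)=0$ if $x\in\mathbb{Z}$; $\overline{E}_{n}(x)=(-1)^{[x]}E_{n}(\{x\})$ for $n\ge1$. Bernoulli functions: $\overline{B}_0(x)=1$; $\overline{B}_1(x)=((x))$, where $((x))=\{x\}-\tfrac12$ for $x\notin\mathbb{Z}$ and $((x))=0$ for $x\in\mathbb{Z}$; $\overline{B}_n(x)=B_n(\{x\})$ for $n\ge2$. Generalized Hardy–Berndt sums: for $m,n\in\mathbb{N}_0$, $a,b,c\in\mathbb{Z}$ with $c\neq0$, and $x,y,z\in\mathbb{R}$, $$S_{m,n}^{(5)}\begin{pmatrix} a & b & c\\ x & y & z\end{pmatrix}=\sum_{r=0}^{|c|-1}(-1)^{r}\,\overline{E}_{m}\!\left(\frac{a(r+z)}{c}-x\right)\overline{B}_{n}\!\left(\frac{b(r+z)}{c}-y\right).$$ $\mathrm{sgn}(x)=x/|x|$ for $x\ne0$; $\delta_{l,k}$ is the Kronecker delta; $\delta_{\mathbb{Z}}(x)=1$ if $x\in\mathbb{Z}$ and $0$ otherwise; $(a,b)$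 is the greatest common divisor of $a,b$. *)

theory Defs
  imports "HOL-Analysis.Analysis" "HOL-Computational_Algebra.Formal_Power_Series"
begin

definition euler_poly :: "nat \<Rightarrow> real \<Rightarrow> real" where
  "euler_poly n x = fact n * fps_nth (fps_const 2 * fps_exp x / (fps_exp 1 + 1)) n"

text \<open>Bernoulli polynomials via the generating function t e^{xt}/(e^t-1)
  (exact formal division: e^t - 1 has subdegree 1 and t e^{xt} is divisible by it).\<close>
definition bernoulli_poly :: "nat \<Rightarrow> real \<Rightarrow> real" where
  "bernoulli_poly n x = fact n * fps_nth (fps_X * fps_exp x / (fps_exp 1 - 1)) n"

definition euler_bar :: "nat \<Rightarrow> real \<Rightarrow> real" where
  "euler_bar n x =
     (if n = 0 then (if x \<in> \<int> then 0 else (-1) powi \<lfloor>x\<rfloor>)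
      else (-1) powi \<lfloor>x\<rfloor> * euler_poly n (frac x))"

definition bernoulli_bar :: "nat \<Rightarrow> real \<Rightarrow> real" where
  "bernoulli_bar n x =
     (if n = 0 then 1
      else if n = 1 then (if x \<in> \<int> then 0 else frac x - 1/2)
      else bernoulli_poly n (frac x))"

definition S5 :: "nat \<Rightarrow> nat \<Rightarrow> int \<Rightarrow> int \<Rightarrow> int \<Rightarrow> real \<Rightarrow> real \<Rightarrow> real \<Rightarrow> real" where
  "S5 m n a b c x y z =
     (\<Sum>r<nat \<bar>c\<bar>. (-1) ^ r * euler_bar m (of_int a * (real r + z) / of_int c - x)
                              * bernoulli_bar n (of_int b * (real r + z) / of_int c - y))"

definition delta_Z :: "real \<Rightarrow> real" where
  "delta_Z x = (if x \<in> \<int> then 1 else 0)"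

end

theory Submission
  imports Defs
begin

text \<open>
  For odd \<open>a\<close> the multiplication formula writes \<open>E\<^sub>j(at - y)\<close> as \<open>sgn(a) a\<^sup>j\<close> times the alternating
  sum of \<open>E\<^sub>j(t - (k + y)/a)\<close> over \<open>k\<close> modulo \<open>a\<close>. Expanding every Euler function in this way turns
  the theorem into an alternating double sum of its instances with \<open>a = b = 1\<close>, evaluated at
  \<open>(k + y)/a\<close> and \<open>(r + z)/b\<close>; only the last term needs a separate computation, where the gcd appears.
  For \<open>a = b = 1\<close> one may take \<open>x = 0\<close> and, by antiperiodicity and symmetry, \<open>0 \<le> y \<le> z < 1\<close>. What
  remains is a polynomial identity. Its defect \<open>P\<^sub>m\<^sub>,\<^sub>n(y, z)\<close> satisfies \<open>\<partial>P\<^sub>m\<^sub>,\<^sub>n/\<partial>y = m P\<^sub>m\<^sub>-\<^sub>1\<^sub>,\<^sub>n\<close> and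
  \<open>\<partial>P\<^sub>m\<^sub>,\<^sub>n/\<partial>z = n P\<^sub>m\<^sub>,\<^sub>n\<^sub>-\<^sub>1\<close>, so by induction it is constant, and it changes sign between two corners of
  the unit square.
\<close>

section \<open>Euler and Bernoulli polynomials\<close>

text \<open>A constant that equals the negative of itself is zero. In the inductions on Euler
  polynomials, differentiation leads back to the induction hypothesis and this fixes the constant of
  integration.\<close>

lemma DERIV_zero_antisym_imp_zero:
  fixes f :: "real \<Rightarrow> real"
  assumes "\<And>t. (f has_real_derivative 0) (at t)" and "f u = - f v"
  shows "f t = 0"
proof -
  have "f t = f u" "f v = f u"
    using DERIV_isconst_all[of f] assms(1) by blast+
  with assms(2) show ?thesis by simp
qed

text \<open>Differentiating \<open>G(t) e^(xt)\<close> in \<open>x\<close> multiplies it by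
  \<open>t\<close>, which shifts the coefficients. For \<open>n = 0\<close> the factor
  \<open>real n\<close> makes the truncated index \<open>n - 1\<close> harmless.\<close>

lemma DERIV_appell:
  fixes G :: "real fps"
  shows "((\<lambda>x. fact n * fps_nth (G * fps_exp x) n) has_real_derivative
           real n * (fact (n - 1) * fps_nth (G * fps_exp x) (n - 1))) (at x)"
proof (cases n)
  case 0
  then show ?thesis by (simp add: fps_mult_nth)
next
  case (Suc k)
  have *: "((\<lambda>x. \<Sum>i=0..Suc k. fps_nth G i * (x ^ (Suc k - i) / fact (Suc k - i))) has_real_derivative
          (\<Sum>i=0..k. fps_nth G i * (x ^ (k - i) / fact (k - i)))) (at x)"
  proof -
    have "((\<lambda>x. \<Sum>i=0..Suc k. fps_nth G i * (x ^ (Suc k - i) / fact (Suc k - i))) has_real_derivative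
          (\<Sum>i=0..Suc k. fps_nth G i * (real (Suc k - i) * x ^ (Suc k - i - 1) / fact (Suc k - i)))) (at x)"
      by (auto intro!: derivative_eq_intros sum.cong)
    \<comment> \<open>The term \<open>i = Suc k\<close> is constant in \<open>x\<close> and drops
      out.\<close>
    also have "(\<Sum>i=0..Suc k. fps_nth G i * (real (Suc k - i) * x ^ (Suc k - i - 1) / fact (Suc k - i)))
        = (\<Sum>i=0..k. fps_nth G i * (x ^ (k - i) / fact (k - i)))"
    proof -
      have "fps_nth G i * (real (Suc k - i) * x ^ (Suc k - i - 1) / fact (Suc k - i))
          = fps_nth G i * (x ^ (k - i) / fact (k - i))" if "i \<le> k" for i
        using that by (subst (1 2 3) Suc_diff_le) (simp_all add: fact_Suc del: of_nat_Suc of_nat_diff)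
      then show ?thesis by simp
    qed
    finally show ?thesis .
  qed
  show ?thesis
    unfolding Suc fps_mult_nth fps_exp_nth
    using DERIV_cmult[OF *, of "fact (Suc k)"] by (simp add: mult_ac)
qed

definition euler_gen :: "real fps" where
  "euler_gen = fps_const 2 * inverse (fps_exp 1 + 1)"

lemma euler_gen_mult: "euler_gen * (fps_exp 1 + 1) = fps_const 2"
  unfolding euler_gen_def by (simp add: mult.assoc inverse_mult_eq_1)

lemma euler_poly_conv_gen: "euler_poly n x = fact n * fps_nth (euler_gen * fps_exp x) n"
  unfolding euler_poly_def euler_gen_def by (simp add: fps_divide_unit mult_ac)

text \<open>This is \<open>t / (e^t - 1)\<close>. Since \<open>e^t - 1\<close> is not a unit, one
  factor \<open>t\<close> is cancelled before inverting.\<close>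

definition bernoulli_gen :: "real fps" where
  "bernoulli_gen = inverse (fps_shift 1 (fps_exp 1 - 1))"

lemma fps_exp_minus_1_conv_shift: "fps_exp 1 - 1 = fps_X * (fps_shift 1 (fps_exp 1 - 1) :: real fps)"
  by (rule fps_ext) (simp add: fps_X_mult_nth)

lemma bernoulli_gen_mult: "bernoulli_gen * (fps_exp 1 - 1) = fps_X"
proof -
  have "bernoulli_gen * (fps_exp 1 - 1) = fps_X * (bernoulli_gen * fps_shift 1 (fps_exp 1 - 1))"
    by (subst fps_exp_minus_1_conv_shift) (simp only: mult_ac)
  also have "bernoulli_gen * fps_shift 1 (fps_exp 1 - 1) = 1"
    unfolding bernoulli_gen_def by (rule inverse_mult_eq_1) simp
  finally show ?thesis by simp
qed

lemma bernoulli_poly_conv_gen: "bernoulli_poly n x = fact n * fps_nth (bernoulli_gen * fps_exp x) n"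
proof -
  have nz: "fps_exp 1 - 1 \<noteq> (0 :: real fps)"
    using bernoulli_gen_mult by (metis fps_X_neq_zero mult_zero_right)
  have "fps_X * fps_exp x = (bernoulli_gen * fps_exp x) * (fps_exp 1 - 1)"
    using bernoulli_gen_mult by (metis mult.assoc mult.commute)
  then have "fps_X * fps_exp x / (fps_exp 1 - 1) = bernoulli_gen * fps_exp x"
    using nz by (simp only: nonzero_mult_div_cancel_right not_False_eq_True)
  then show ?thesis by (simp add: bernoulli_poly_def)
qed

lemma DERIV_euler_poly [derivative_intros]:
  assumes "(f has_real_derivative f') (at x)"
  shows "((\<lambda>x. euler_poly n (f x)) has_real_derivative real n * euler_poly (n - 1) (f x) * f') (at x)"
  using DERIV_chain2[OF DERIV_appell assms] unfolding euler_poly_conv_gen .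

lemma DERIV_bernoulli_poly [derivative_intros]:
  assumes "(f has_real_derivative f') (at x)"
  shows "((\<lambda>x. bernoulli_poly n (f x)) has_real_derivative real n * bernoulli_poly (n - 1) (f x) * f') (at x)"
  using DERIV_chain2[OF DERIV_appell assms] unfolding bernoulli_poly_conv_gen .

lemma euler_poly_0 [simp]: "euler_poly 0 x = 1"
  by (simp add: euler_poly_conv_gen euler_gen_def)

lemma bernoulli_poly_0 [simp]: "bernoulli_poly 0 x = 1"
  by (simp add: bernoulli_poly_conv_gen bernoulli_gen_def)

lemma euler_poly_1_eq_neg:
  assumes "n > 0"
  shows "euler_poly n 1 = - euler_poly n 0"
proof -
  have "fps_nth (euler_gen * fps_exp 1) n + fps_nth (euler_gen * fps_exp 0) n
      = fps_nth (euler_gen * (fps_exp 1 + 1)) n"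
    by (simp add: algebra_simps)
  also have "\<dots> = 0" using assms by (simp add: euler_gen_mult)
  finally have "fps_nth (euler_gen * fps_exp 1) n = - fps_nth (euler_gen * fps_exp 0) n" by linarith
  then show ?thesis by (simp add: euler_poly_conv_gen)
qed

text \<open>The difference of the two values is a coefficient of
  \<open>bernoulli_gen * (fps_exp 1 - 1)\<close>, which is just \<open>t\<close>.\<close>

lemma bernoulli_poly_at_1:
  "bernoulli_poly n 1 = bernoulli_poly n 0 + of_bool (n = 1)"
proof -
  have "fps_nth (bernoulli_gen * fps_exp 1) n - fps_nth (bernoulli_gen * fps_exp 0) n
      = fps_nth (bernoulli_gen * (fps_exp 1 - 1)) n"
    by (simp add: algebra_simps)
  also have "\<dots> = of_bool (n = 1)" by (simp add: bernoulli_gen_mult fps_X_def)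
  finally have "fps_nth (bernoulli_gen * fps_exp 1) n = fps_nth (bernoulli_gen * fps_exp 0) n + of_bool (n = 1)"
    by linarith
  then show ?thesis by (simp add: bernoulli_poly_conv_gen algebra_simps)
qed

text \<open>By the induction hypothesis the difference of the two sides is constant, and it changes
  sign between 0 and 1 because \<open>E_n(1) = - E_n(0)\<close> for \<open>n > 0\<close>.\<close>

lemma euler_poly_reflect: "euler_poly n (1 - x) = (-1) ^ n * euler_poly n x"
proof (induction n arbitrary: x)
  case 0
  show ?case by simp
next
  case (Suc n)
  let ?f = "\<lambda>x. euler_poly (Suc n) (1 - x) - (-1) ^ Suc n * euler_poly (Suc n) x"
  have "?f x = 0"
  proof (rule DERIV_zero_antisym_imp_zero[of ?f])
    fix t show "(?f has_real_derivative 0) (at t)"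
      by (rule derivative_eq_intros refl)+ (simp add: Suc.IH)
    show "?f 0 = - ?f 1" by (simp add: euler_poly_1_eq_neg)
  qed
  then show ?case by simp
qed

text \<open>For even \<open>n > 0\<close> this says \<open>E_n(0) = 0\<close>, which is what makes
  the periodic Euler functions behave well under reflection at integers.\<close>

lemma euler_poly_0_eq_neg:
  assumes "n > 0"
  shows "(-1) ^ n * euler_poly n 0 = - euler_poly n 0"
  using euler_poly_reflect[of n 0] euler_poly_1_eq_neg[OF assms] by simp

section \<open>Multiplication formula for Euler polynomials\<close>

lemma sum_minus_one_power_odd:
  assumes "odd q"
  shows "(\<Sum>k<q. (-1) ^ k :: real) = 1"
  using assms by (simp add: sum_gp_strict)

text \<open>Shifting the index leaves the boundary terms \<open>- f 0\<close> and
  \<open>(-1) ^ q * f q\<close>, which cancel.\<close>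

lemma sum_alternating_shift:
  fixes f :: "nat \<Rightarrow> real"
  assumes "odd q" and "f q = - f 0"
  shows "(\<Sum>k<q. (-1) ^ k * f (Suc k)) = - (\<Sum>k<q. (-1) ^ k * f k)"
proof -
  have "(\<Sum>k<q. (-1) ^ k * f (Suc k)) = - (\<Sum>k<q. (-1) ^ Suc k * f (Suc k))"
    by (simp add: sum_negf)
  also have "(\<Sum>k<q. (-1) ^ Suc k * f (Suc k)) = (\<Sum>k<Suc q. (-1) ^ k * f k) - f 0"
    by (subst sum.lessThan_Suc_shift) simp
  also have "\<dots> = (\<Sum>k<q. (-1) ^ k * f k)"
    using assms by simp
  finally show ?thesis .
qed

text \<open>The difference of the two sides has derivative zero by induction. Moving
  \<open>x\<close> from 0 to \<open>1 / q\<close> shifts \<open>k\<close> by one and moves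
  \<open>q * x\<close> from 0 to 1, so both sides change sign.\<close>

lemma euler_poly_mult:
  assumes "odd q"
  shows "real q ^ n * (\<Sum>k<q. (-1) ^ k * euler_poly n (x + real k / real q)) = euler_poly n (real q * x)"
proof (induction n arbitrary: x)
  case 0
  show ?case using sum_minus_one_power_odd[OF assms] by simp
next
  case (Suc n)
  have q: "q > 0" using assms odd_pos by blast
  let ?f = "\<lambda>x. real q ^ Suc n * (\<Sum>k<q. (-1) ^ k * euler_poly (Suc n) (x + real k / real q))
              - euler_poly (Suc n) (real q * x)"
  have "?f x = 0"
  proof (rule DERIV_zero_antisym_imp_zero[of ?f])
    fix t
    have "(?f has_real_derivative real q ^ Suc n * (\<Sum>k<q. (-1) ^ k * (real (Suc n) * euler_poly n (t + real k / real q)))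
             - real (Suc n) * euler_poly n (real q * t) * real q) (at t)"
      by (auto intro!: derivative_eq_intros sum.cong)
    also have "real q ^ Suc n * (\<Sum>k<q. (-1) ^ k * (real (Suc n) * euler_poly n (t + real k / real q)))
        = real (Suc n) * real q * (real q ^ n * (\<Sum>k<q. (-1) ^ k * euler_poly n (t + real k / real q)))"
      by (simp add: sum_distrib_left mult_ac del: of_nat_Suc)
    finally show "(?f has_real_derivative 0) (at t)"
      by (simp add: Suc.IH mult_ac)
    show "?f (1 / real q) = - ?f 0"
      using sum_alternating_shift[OF assms, of "\<lambda>k. euler_poly (Suc n) (real k / real q)"] q
      by (simp add: euler_poly_1_eq_neg add_divide_distrib)
  qed
  then show ?case by simp
qed

lemma euler_poly_1: "euler_poly 1 x = x - 1 / 2"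
proof -
  let ?f = "\<lambda>x. euler_poly 1 x - (x - 1 / 2)"
  have "?f x = 0"
  proof (rule DERIV_zero_antisym_imp_zero[of ?f])
    show "(?f has_real_derivative 0) (at t)" for t
      by (auto intro!: derivative_eq_intros)
    show "?f 1 = - ?f 0" by (simp add: euler_poly_1_eq_neg)
  qed
  then show ?thesis by simp
qed

lemma bernoulli_poly_1: "bernoulli_poly 1 x = x - 1 / 2"
proof -
  have c: "bernoulli_poly 1 x - x = bernoulli_poly 1 0 - 0" for x
  proof -
    have "((\<lambda>x. bernoulli_poly 1 x - x) has_real_derivative 0) (at t)" for t
      by (auto intro!: derivative_eq_intros)
    then show ?thesis by (rule DERIV_isconst_all[rule_format])
  qed
  \<comment> \<open>The coefficient of \<open>t^2\<close> in
    \<open>bernoulli_gen * (fps_exp 1 - 1)\<close> determines the constant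
    \<open>B_1(0)\<close>.\<close>
  have "fps_nth (bernoulli_gen * (fps_exp 1 - 1)) 2 = 0"
    by (simp add: bernoulli_gen_mult)
  then have "fps_nth bernoulli_gen 1 = - 1 / 2"
    by (simp add: fps_mult_nth numeral_2_eq_2 bernoulli_gen_def)
  then have "bernoulli_poly 1 0 = - 1 / 2"
    by (simp add: bernoulli_poly_conv_gen)
  with c[of x] show ?thesis by simp
qed

section \<open>Mixed sums of Euler and Bernoulli polynomials\<close>

text \<open>The sum over \<open>j\<close> in the theorem for \<open>a = b = 1\<close> has
  \<open>e = -1\<close>; the sign \<open>e = 1\<close> arises by reflecting the Euler factor.
  Keeping \<open>f\<close> and \<open>g\<close> abstract serves the polynomials and the periodic
  functions alike. All denominators are at least \<open>n + 1\<close>.\<close>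

definition mixed_sum :: "(nat \<Rightarrow> real) \<Rightarrow> (nat \<Rightarrow> real) \<Rightarrow> real \<Rightarrow> nat \<Rightarrow> nat \<Rightarrow> real" where
  "mixed_sum f g e m n = (\<Sum>j\<le>m. real (m choose j) * e ^ j / real (m + n + 1 - j) * f j * g (m + n + 1 - j))"

abbreviation mixed_poly :: "real \<Rightarrow> nat \<Rightarrow> nat \<Rightarrow> real \<Rightarrow> real \<Rightarrow> real" where
  "mixed_poly e m n w z \<equiv> mixed_sum (\<lambda>j. euler_poly j w) (\<lambda>j. bernoulli_poly j z) e m n"

text \<open>Absorption \<open>j * (m choose j) = m * (m - 1 choose j - 1)\<close>, followed by the
  shift of \<open>j\<close>; lowering \<open>m\<close> and \<open>j\<close> together keeps the index
  \<open>m + n + 1 - j\<close>.\<close>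

lemma sum_binomial_absorb_shift:
  "(\<Sum>j\<le>m. real (m choose j) * e ^ j / real (m + n + 1 - j) * (real j * f (j - 1)) * g (m + n + 1 - j))
     = e * real m * mixed_sum f g e (m - 1) n"
proof (cases m)
  case (Suc k)
  have c: "real (Suc k choose Suc j) * real (Suc j) = real (Suc k) * real (k choose j)" for j
    by (metis Suc_times_binomial mult.commute of_nat_mult)
  have "real (Suc k choose Suc j) * e ^ Suc j / real (k + n + 1 - j) * (real (Suc j) * f j) * g (k + n + 1 - j)
      = e * real (Suc k) * (real (k choose j) * e ^ j / real (k + n + 1 - j) * f j * g (k + n + 1 - j))" for j
  proof -
    have "real (Suc k choose Suc j) * e ^ Suc j / real (k + n + 1 - j) * (real (Suc j) * f j) * g (k + n + 1 - j)
      = (real (Suc k choose Suc j) * real (Suc j)) * e ^ Suc j / real (k + n + 1 - j) * f j * g (k + n + 1 - j)"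
      by (simp only: mult_ac times_divide_eq_left times_divide_eq_right)
    then show ?thesis unfolding c by (simp add: mult_ac)
  qed
  moreover have "Suc k + n + 1 - Suc j = k + n + 1 - j" "Suc j - 1 = j" "Suc k - 1 = k" for j
    by simp_all
  ultimately show ?thesis
    unfolding Suc mixed_sum_def sum.atMost_Suc_shift sum_distrib_left
    by (simp only: of_nat_0 mult_zero_left mult_zero_right add_0_left)
qed simp

lemma DERIV_mixed_poly_fst:
  "((\<lambda>w. mixed_poly e m n w z) has_real_derivative
     e * real m * mixed_poly e (m - 1) n w z) (at w)"
  unfolding sum_binomial_absorb_shift[symmetric]
  unfolding mixed_sum_def by (auto intro!: derivative_eq_intros sum.cong)

text \<open>After an index shift, the derivatives of the Euler and of the Bernoulli factors are
  multiples of the same terms \<open>T j\<close>, with weights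
  \<open>- (m - j) / (m + n - j)\<close> and 1. For \<open>n > 0\<close> the weights add up to
  \<open>n / (m + n - j)\<close>, which again gives a mixed sum; for \<open>n = 0\<close> only
  \<open>j = m\<close> survives.\<close>

lemma DERIV_mixed_poly_diag:
  assumes "e * e = 1"
  shows "((\<lambda>t. mixed_poly e m n (c - e * t) t) has_real_derivative
     (if n = 0 then e ^ m * euler_poly m (c - e * t)
      else real n * mixed_poly e m (n - 1) (c - e * t) t)) (at t)"
proof -
  define w where "w = c - e * t"
  define T where "T = (\<lambda>j. e ^ j * real (m choose j) * euler_poly j w * bernoulli_poly (m + n - j) t)"
  have D: "((\<lambda>t. mixed_poly e m n (c - e * t) t) has_real_derivative
     (\<Sum>j\<le>m. real (m choose j) * e ^ j / real (m + n + 1 - j) *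
        (- e * real j * euler_poly (j - 1) w * bernoulli_poly (m + n + 1 - j) t
          + euler_poly j w * (real (m + n + 1 - j) * bernoulli_poly (m + n - j) t)))) (at t)"
  proof -
    have *: "((\<lambda>t. C * euler_poly j (c - e * t) * bernoulli_poly K t) has_real_derivative
        C * (- e * real j * euler_poly (j - 1) w * bernoulli_poly K t
          + euler_poly j w * (real K * bernoulli_poly L t))) (at t)" if "K - 1 = L" for C j K L
      unfolding w_def that[symmetric] by (rule derivative_eq_intros refl)+ (simp add: algebra_simps)
    show ?thesis unfolding mixed_sum_def by (intro DERIV_sum *) simp
  qed
  have "(\<Sum>j\<le>m. real (m choose j) * e ^ j / real (m + n + 1 - j) *
        (- e * real j * euler_poly (j - 1) w * bernoulli_poly (m + n + 1 - j) t
          + euler_poly j w * (real (m + n + 1 - j) * bernoulli_poly (m + n - j) t)))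
      = (\<Sum>j\<le>m. real (m choose j) * e ^ j / real (m + n + 1 - j) *
        (- e * real j * euler_poly (j - 1) w * bernoulli_poly (m + n + 1 - j) t)) + (\<Sum>j\<le>m. T j)"
    unfolding sum.distrib[symmetric] T_def
    by (intro sum.cong refl) (simp add: field_simps del: of_nat_diff)
  also have "(\<Sum>j\<le>m. real (m choose j) * e ^ j / real (m + n + 1 - j) *
        (- e * real j * euler_poly (j - 1) w * bernoulli_poly (m + n + 1 - j) t))
      = - e * (e * real m * mixed_poly e (m - 1) n w t)"
    unfolding sum_binomial_absorb_shift[symmetric] sum_distrib_left
    by (intro sum.cong refl) (simp add: mult_ac)
  \<comment> \<open>The inner derivative \<open>- e\<close> meets the factor \<open>e\<close> of the
    index shift, so \<open>e * e = 1\<close> leaves a plain sign.\<close>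
  also have "\<dots> = - (\<Sum>j\<le>m. real (m - j) / real (m + n - j) * T j)"
  proof (cases m)
    case (Suc k)
    have "real (Suc k) * (real (k choose j) * e ^ j / real (k + n + 1 - j) * euler_poly j w * bernoulli_poly (k + n + 1 - j) t)
        = real (Suc k - j) / real (Suc k + n - j) * T j" if "j \<le> k" for j
    proof -
      have "real (Suc k) * real (k choose j) = real (Suc k - j) * real (Suc k choose j)"
        using binomial_absorb_comp[of "Suc k" j] unfolding of_nat_mult[symmetric] by simp
      then show ?thesis unfolding T_def Suc
        by (simp add: mult_ac field_simps del: of_nat_diff of_nat_Suc)
    qed
    then have "real m * mixed_poly e (m - 1) n w t = (\<Sum>j\<le>k. real (m - j) / real (m + n - j) * T j)"
      unfolding mixed_sum_def sum_distrib_left Suc by (auto intro!: sum.cong)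
    also have "\<dots> = (\<Sum>j\<le>m. real (m - j) / real (m + n - j) * T j)"
      unfolding Suc by simp
    finally have "- (e * e) * (real m * mixed_poly e (m - 1) n w t)
        = - (\<Sum>j\<le>m. real (m - j) / real (m + n - j) * T j)"
      using assms by (simp only: mult_minus_left mult_1_left)
    then show ?thesis by (simp only: mult.assoc mult_minus_left)
  qed simp
  also have "- (\<Sum>j\<le>m. real (m - j) / real (m + n - j) * T j) + (\<Sum>j\<le>m. T j)
      = (\<Sum>j\<le>m. (1 - real (m - j) / real (m + n - j)) * T j)"
    by (simp add: algebra_simps sum_subtractf)
  also have "\<dots> = (if n = 0 then e ^ m * euler_poly m w else real n * mixed_poly e m (n - 1) w t)"
  proof (cases n)
    case 0
    \<comment> \<open>Here the quotient is 1 for \<open>j < m\<close>, but \<open>0 / 0 = 0\<close>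
      for \<open>j = m\<close>.\<close>
    have "(\<Sum>j\<le>m. (1 - real (m - j) / real (m + n - j)) * T j) = (\<Sum>j\<le>m. if j = m then T j else 0)"
      by (intro sum.cong) (auto simp: 0 simp del: of_nat_diff)
    also have "\<dots> = T m" by simp
    finally show ?thesis by (simp add: 0 T_def)
  next
    case (Suc k)
    have "(1 - real (m - j) / real (m + n - j)) * T j
       = real n * (real (m choose j) * e ^ j / real (m + k + 1 - j) * euler_poly j w * bernoulli_poly (m + k + 1 - j) t)"
      if "j \<le> m" for j
    proof -
      have "1 - real (m - j) / real (m + n - j) = real n / real (m + n - j)"
        using that Suc by (simp add: field_simps)
      then show ?thesis unfolding T_def by (simp add: Suc)
    qed
    then show ?thesis unfolding mixed_sum_def sum_distrib_left Suc by (auto intro!: sum.cong)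
  qed
  finally show ?thesis using D unfolding w_def by (simp only:)
qed

text \<open>For \<open>j > 0\<close> the values \<open>E_j(1)\<close> and \<open>E_j(0)\<close>
  cancel; only \<open>j = 0\<close> is left.\<close>

lemma mixed_poly_endpoints_fst:
  "mixed_poly e m n 1 z + mixed_poly e m n 0 z = 2 * bernoulli_poly (m + n + 1) z / real (m + n + 1)"
proof -
  have "mixed_poly e m n 1 z + mixed_poly e m n 0 z =
     (\<Sum>j\<le>m. if j = 0 then 2 * bernoulli_poly (m + n + 1) z / real (m + n + 1) else 0)"
    unfolding mixed_sum_def sum.distrib[symmetric]
    by (intro sum.cong refl) (auto simp: euler_poly_1_eq_neg)
  then show ?thesis by simp
qed

text \<open>With \<open>n > 0\<close> every Bernoulli index is at least 2, so the jump of
  \<open>B_1\<close> does not occur.\<close>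

lemma mixed_poly_endpoints_snd:
  assumes "n > 0"
  shows "mixed_poly e m n w 1 = mixed_poly e m n w 0"
  unfolding mixed_sum_def using assms by (intro sum.cong refl) (auto simp: bernoulli_poly_at_1)

section \<open>The polynomial identity for coefficients one\<close>

text \<open>
  Left minus right side of the theorem for \<open>a = b = 1\<close>, \<open>x = 0\<close> and \<open>0 < y < z < 1\<close>,
  where all periodic functions agree with polynomials.
\<close>

definition defect_poly :: "nat \<Rightarrow> nat \<Rightarrow> real \<Rightarrow> real \<Rightarrow> real" where
  "defect_poly m n y z = 2 * mixed_poly (-1) m n (z - y) z - 2 * mixed_poly 1 n m (z - y) y
     - euler_poly m y * euler_poly n z
     - (-1) ^ m * 2 * fact m * fact n / fact (m + n + 1) * euler_poly (m + n + 1) (z - y)"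

text \<open>The first mixed sum varies along its diagonal with \<open>e = -1\<close>, the second
  only in its Euler argument. For \<open>n = 0\<close> the boundary term
  \<open>(-1) ^ m * euler_poly m (z - y)\<close> of the diagonal derivative cancels the derivative
  of the last term.\<close>

lemma DERIV_defect_poly_snd:
  "((\<lambda>z. defect_poly m n y z) has_real_derivative real n * defect_poly m (n - 1) y z) (at z)"
proof -
  have 1: "((\<lambda>z. mixed_poly (-1) m n (z - y) z) has_real_derivative
     (if n = 0 then (-1) ^ m * euler_poly m (z - y)
      else real n * mixed_poly (-1) m (n - 1) (z - y) z)) (at z)"
    using DERIV_mixed_poly_diag[where e = "-1" and m = m and n = n and c = "-y" and t = z]
    by (simp only: mult_minus_left mult_1_left minus_minus diff_minus_eq_add uminus_add_conv_diff)
  have g: "((\<lambda>z. z - y) has_real_derivative 1) (at z)"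
    by (auto intro!: derivative_eq_intros)
  have 2: "((\<lambda>z. mixed_poly 1 n m (z - y) y) has_real_derivative
     real n * mixed_poly 1 (n - 1) m (z - y) y) (at z)"
    using DERIV_chain2[where g = "\<lambda>z. z - y" and Db = 1 and x = z,
        OF DERIV_mixed_poly_fst[where e = 1 and m = n and n = m and z = y and w = "z - y"] g]
    by simp
  have 3: "((\<lambda>z. (-1) ^ m * 2 * fact m * fact n / fact (m + n + 1) * euler_poly (m + n + 1) (z - y)) has_real_derivative
     ((-1) ^ m * 2 * fact m * fact n / fact (m + n) * euler_poly (m + n) (z - y))) (at z)"
    by (rule derivative_eq_intros refl)+ (simp add: fact_Suc divide_simps del: of_nat_Suc of_nat_add)
  have 4: "((\<lambda>z. euler_poly m y * euler_poly n z) has_real_derivative euler_poly m y * (real n * euler_poly (n - 1) z)) (at z)"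
    by (rule derivative_eq_intros refl)+ simp
  note D = DERIV_diff[OF DERIV_diff[OF DERIV_diff[OF DERIV_cmult[OF 1, of 2] DERIV_cmult[OF 2, of 2]] 4] 3]
  show ?thesis
  proof (cases n)
    case 0
    then show ?thesis using D by (simp add: defect_poly_def)
  next
    case (Suc k)
    have "(fact (Suc k) :: real) = real (Suc k) * fact k" by (rule fact_Suc)
    then show ?thesis using D unfolding defect_poly_def Suc
      by (simp add: algebra_simps del: of_nat_Suc fact_Suc)
  qed
qed

text \<open>The roles of the two mixed sums are exchanged: now the second one varies along its
  diagonal, with \<open>e = 1\<close>.\<close>

lemma DERIV_defect_poly_fst:
  "((\<lambda>y. defect_poly m n y z) has_real_derivative real m * defect_poly (m - 1) n y z) (at y)"
proof -
  have 1: "((\<lambda>y. mixed_poly 1 n m (z - y) y) has_real_derivative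
     (if m = 0 then euler_poly n (z - y)
      else real m * mixed_poly 1 n (m - 1) (z - y) y)) (at y)"
    using DERIV_mixed_poly_diag[where e = 1 and m = n and n = m and c = z and t = y]
    by (simp only: mult_1_left power_one)
  have g: "((\<lambda>y. z - y) has_real_derivative -1) (at y)"
    by (auto intro!: derivative_eq_intros)
  have 2: "((\<lambda>y. mixed_poly (-1) m n (z - y) z) has_real_derivative
     real m * mixed_poly (-1) (m - 1) n (z - y) z) (at y)"
    using DERIV_chain2[where g = "\<lambda>y. z - y" and Db = "-1" and x = y,
        OF DERIV_mixed_poly_fst[where e = "-1" and m = m and n = n and z = z and w = "z - y"] g]
    by simp
  have 3: "((\<lambda>y. (-1) ^ m * 2 * fact m * fact n / fact (m + n + 1) * euler_poly (m + n + 1) (z - y)) has_real_derivative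
     - ((-1) ^ m * 2 * fact m * fact n / fact (m + n) * euler_poly (m + n) (z - y))) (at y)"
    by (rule derivative_eq_intros refl)+ (simp add: fact_Suc divide_simps del: of_nat_Suc of_nat_add)
  have 4: "((\<lambda>y. euler_poly m y * euler_poly n z) has_real_derivative real m * euler_poly (m - 1) y * euler_poly n z) (at y)"
    by (rule derivative_eq_intros refl)+ simp
  note D = DERIV_diff[OF DERIV_diff[OF DERIV_diff[OF DERIV_cmult[OF 2, of 2] DERIV_cmult[OF 1, of 2]] 4] 3]
  show ?thesis
  proof (cases m)
    case 0
    then show ?thesis using D by (simp add: defect_poly_def)
  next
    case (Suc k)
    have "(fact (Suc k) :: real) = real (Suc k) * fact k" by (rule fact_Suc)
    then show ?thesis using D unfolding defect_poly_def Suc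
      by (simp add: algebra_simps del: of_nat_Suc fact_Suc)
  qed
qed

text \<open>By induction both partial derivatives vanish. Apart from \<open>m = n = 0\<close>, which
  is checked directly, the constant is found by adding the values at the two ends of an edge of the
  unit square along which \<open>z - y\<close> runs from 0 to 1; the edge is chosen so that no jump
  of \<open>B_1\<close> interferes.\<close>

lemma defect_poly_eq_0: "defect_poly m n y z = 0"
proof (induction "m + n" arbitrary: m n y z rule: less_induct)
  case less
  have "real m * defect_poly (m - 1) n y z = 0" for y z
    using less.hyps[of "m - 1" n] by (cases m) auto
  then have y: "((\<lambda>y. defect_poly m n y z) has_real_derivative 0) (at y)" for y z
    using DERIV_defect_poly_fst[of m n z y] by (simp only:)
  have "real n * defect_poly m (n - 1) y z = 0" for y z
    using less.hyps[of m "n - 1"] by (cases n) auto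
  then have z: "((\<lambda>z. defect_poly m n y z) has_real_derivative 0) (at z)" for y z
    using DERIV_defect_poly_snd[of m n y z] by (simp only:)
  have const: "defect_poly m n y z = defect_poly m n y' z'" for y z y' z'
    using DERIV_isconst_all[of "\<lambda>y. defect_poly m n y z" y y'] y
          DERIV_isconst_all[of "\<lambda>z. defect_poly m n y' z" z z'] z by simp
  have *: "(-1) ^ m * euler_poly (m + n + 1) 1 = - ((-1) ^ m * euler_poly (m + n + 1) 0)"
    by (simp add: euler_poly_1_eq_neg)
  consider "m = 0" "n = 0" | "n > 0" | "m > 0" by blast
  then show ?case
  proof cases
    case 1
    then show ?thesis
      using bernoulli_poly_1 euler_poly_1
      by (simp add: defect_poly_def mixed_sum_def)
  next
    case 2
    have "defect_poly m n 0 0 + defect_poly m n 0 1 = 0"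
      using mixed_poly_endpoints_fst[where e = "-1" and m = m and n = n and z = 0] mixed_poly_endpoints_fst[where e = 1 and m = n and n = m and z = 0] 2
      by (simp add: defect_poly_def mixed_poly_endpoints_snd euler_poly_1_eq_neg algebra_simps)
    then show ?thesis using const[of y z 0 0] const[of y z 0 1] by simp
  next
    case 3
    have "bernoulli_poly (m + n + 1) 1 = bernoulli_poly (m + n + 1) 0"
      using 3 by (simp add: bernoulli_poly_at_1)
    then have "defect_poly m n 1 1 + defect_poly m n 0 1 = 0"
      using mixed_poly_endpoints_fst[where e = "-1" and m = m and n = n and z = 1] mixed_poly_endpoints_fst[where e = 1 and m = n and n = m and z = 0] 3
      by (simp add: defect_poly_def mixed_poly_endpoints_snd euler_poly_1_eq_neg algebra_simps)
    then show ?thesis using const[of y z 1 1] const[of y z 0 1] by simp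
  qed
qed

section \<open>Translation and reflection of the periodic functions\<close>

lemma euler_bar_add_of_int: "euler_bar n (w + of_int i) = (-1) powi i * euler_bar n w"
  by (simp add: euler_bar_def power_int_add)

lemma bernoulli_bar_add_of_int: "bernoulli_bar n (w + of_int i) = bernoulli_bar n w"
  by (simp add: bernoulli_bar_def)

text \<open>The correction stems from the convention that \<open>euler_bar 0\<close> vanishes at
  integers whereas \<open>E_0 = 1\<close>. This and the analogous correction for
  \<open>bernoulli_bar 1\<close> are what produce the delta term of the theorem.\<close>

lemma euler_bar_unit:
  assumes "0 \<le> w" "w < 1"
  shows "euler_bar n w = euler_poly n w - of_bool (n = 0 \<and> w = 0)"
proof -
  have "\<lfloor>w\<rfloor> = 0" using assms by linarith
  moreover have "w \<in> \<int> \<longleftrightarrow> w = 0" using calculation by (metis Ints_0 Ints_cases floor_of_int of_int_0)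
  ultimately show ?thesis by (auto simp: euler_bar_def frac_def)
qed

lemma bernoulli_bar_unit:
  assumes "0 \<le> w" "w < 1"
  shows "bernoulli_bar n w = bernoulli_poly n w + of_bool (n = 1 \<and> w = 0) / 2"
proof -
  have "\<lfloor>w\<rfloor> = 0" using assms by linarith
  moreover have "w \<in> \<int> \<longleftrightarrow> w = 0" using calculation by (metis Ints_0 Ints_cases floor_of_int of_int_0)
  ultimately show ?thesis using bernoulli_poly_1[of w] by (auto simp: bernoulli_bar_def frac_def)
qed

lemma minus_one_powi_minus: "(-1 :: real) powi (- i) = (-1) powi i"
  by (simp add: power_int_minus flip: power_int_inverse)

text \<open>The correction term of the theorem is a product of two values of this function.\<close>

definition int_sign :: "real \<Rightarrow> real" where
  "int_sign w = (-1) powi \<lfloor>w\<rfloor> * delta_Z w"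

lemma int_sign_add_of_int: "int_sign (w + of_int i) = (-1) powi i * int_sign w"
  by (simp add: int_sign_def delta_Z_def power_int_add)

lemma int_sign_unit:
  assumes "0 \<le> w" "w < 1"
  shows "int_sign w = of_bool (w = 0)"
proof -
  have "\<lfloor>w\<rfloor> = 0" using assms by linarith
  moreover have "w \<in> \<int> \<longleftrightarrow> w = 0" using calculation by (metis Ints_0 Ints_cases floor_of_int of_int_0)
  ultimately show ?thesis by (auto simp: int_sign_def delta_Z_def)
qed

text \<open>At integers the floor is additive, so the single power of -1 in the theorem splits;
  elsewhere both sides vanish.\<close>

lemma int_sign_mult:
  "(-1) powi \<lfloor>u + v\<rfloor> * delta_Z u * delta_Z v = int_sign u * int_sign v"
  by (auto simp: int_sign_def delta_Z_def power_int_add elim!: Ints_cases)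

lemma int_sign_minus: "int_sign (- w) = int_sign w"
  by (auto simp: int_sign_def delta_Z_def minus_one_powi_minus elim!: Ints_cases)

text \<open>For a nonzero fractional part \<open>f\<close>, write \<open>- f = (1 - f) - 1\<close>:
  the reflection formula gives \<open>(-1) ^ n\<close> and antiperiodicity one more sign. At
  \<open>f = 0\<close> the claim rests on \<open>E_n(0) = 0\<close> for even \<open>n > 0\<close>
  and on \<open>euler_bar 0 0 = 0\<close>.\<close>

lemma euler_bar_minus: "euler_bar n (- w) = (-1) ^ Suc n * euler_bar n w"
proof -
  define f where "f = frac w"
  have f: "0 \<le> f" "f < 1" by (simp_all add: f_def frac_lt_1)
  have w: "w = f + of_int \<lfloor>w\<rfloor>" by (simp add: f_def frac_def)
  have *: "euler_bar n (- f) = (-1) ^ Suc n * euler_bar n f"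
  proof (cases "f = 0")
    case True
    then show ?thesis using euler_poly_0_eq_neg[of n] by (cases "n = 0") (simp_all add: euler_bar_unit)
  next
    case False
    have "- f = (1 - f) + of_int (-1)" by simp
    then have "euler_bar n (- f) = - euler_bar n (1 - f)"
      by (metis euler_bar_add_of_int mult_minus1 power_int_minus_one_minus power_int_1_right
           minus_one_powi_minus)
    also have "euler_bar n (1 - f) = euler_poly n (1 - f)"
      using False f by (simp add: euler_bar_unit)
    finally show ?thesis using False f by (simp add: euler_bar_unit euler_poly_reflect)
  qed
  have "- w = - f + of_int (- \<lfloor>w\<rfloor>)" using w by simp
  then have "euler_bar n (- w) = (-1) powi (- \<lfloor>w\<rfloor>) * euler_bar n (- f)"
    by (metis euler_bar_add_of_int)
  also have "\<dots> = (-1) ^ Suc n * ((-1) powi \<lfloor>w\<rfloor> * euler_bar n f)"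
    by (simp add: * minus_one_powi_minus)
  also have "(-1) powi \<lfloor>w\<rfloor> * euler_bar n f = euler_bar n w"
    using w by (metis euler_bar_add_of_int)
  finally show ?thesis .
qed

section \<open>The theorem for coefficients one\<close>

text \<open>The Euler correction occurs only at \<open>j = 0\<close>, the Bernoulli correction only
  at index 1, that is for \<open>j = m\<close> and \<open>n = 0\<close>. Multiplying the former by
  \<open>bernoulli_bar\<close> rather than by the polynomial avoids a cross term.\<close>

lemma mixed_sum_bar_unit:
  assumes "0 \<le> w" "w < 1" "0 \<le> z" "z < 1"
  shows "mixed_sum (\<lambda>j. euler_bar j w) (\<lambda>j. bernoulli_bar j z) e m n
    = mixed_poly e m n w z - of_bool (w = 0) * bernoulli_bar (m + n + 1) z / real (m + n + 1)
      + of_bool (n = 0 \<and> z = 0) * e ^ m * euler_poly m w / 2"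
proof -
  have "mixed_sum (\<lambda>j. euler_bar j w) (\<lambda>j. bernoulli_bar j z) e m n =
     (\<Sum>j\<le>m. real (m choose j) * e ^ j / real (m + n + 1 - j) * euler_poly j w * bernoulli_poly (m + n + 1 - j) z
        - (if j = 0 then of_bool (w = 0) * bernoulli_bar (m + n + 1) z / real (m + n + 1) else 0)
        + (if j = m then of_bool (n = 0 \<and> z = 0) * e ^ m * euler_poly m w / 2 else 0))"
    unfolding mixed_sum_def
  proof (intro sum.cong refl)
    fix j assume "j \<in> {..m}"
    then have "m + n + 1 - j = 1 \<longleftrightarrow> j = m \<and> n = 0" by auto
    then have B: "bernoulli_bar (m + n + 1 - j) z =
        bernoulli_poly (m + n + 1 - j) z + of_bool (j = m \<and> n = 0 \<and> z = 0) / 2"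
      using bernoulli_bar_unit[OF assms(3,4), of "m + n + 1 - j"] by simp
    have E: "euler_bar j w = euler_poly j w - of_bool (j = 0 \<and> w = 0)"
      using euler_bar_unit[OF assms(1,2)] .
    define K where "K = real (m choose j) * e ^ j / real (m + n + 1 - j)"
    have "K * euler_bar j w * bernoulli_bar (m + n + 1 - j) z =
       K * euler_poly j w * bernoulli_poly (m + n + 1 - j) z
       - K * of_bool (j = 0 \<and> w = 0) * bernoulli_bar (m + n + 1 - j) z
       + K * euler_poly j w * (of_bool (j = m \<and> n = 0 \<and> z = 0) / 2)"
      unfolding B E by (simp add: algebra_simps)
    moreover have "K * of_bool (j = 0 \<and> w = 0) * bernoulli_bar (m + n + 1 - j) z
      = (if j = 0 then of_bool (w = 0) * bernoulli_bar (m + n + 1) z / real (m + n + 1) else 0)"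
      by (simp add: K_def)
    moreover have "K * euler_poly j w * (of_bool (j = m \<and> n = 0 \<and> z = 0) / 2)
      = (if j = m then of_bool (n = 0 \<and> z = 0) * e ^ m * euler_poly m w / 2 else 0)"
      by (auto simp: K_def)
    ultimately show "real (m choose j) * e ^ j / real (m + n + 1 - j) * euler_bar j w * bernoulli_bar (m + n + 1 - j) z
      = real (m choose j) * e ^ j / real (m + n + 1 - j) * euler_poly j w * bernoulli_poly (m + n + 1 - j) z
        - (if j = 0 then of_bool (w = 0) * bernoulli_bar (m + n + 1) z / real (m + n + 1) else 0)
        + (if j = m then of_bool (n = 0 \<and> z = 0) * e ^ m * euler_poly m w / 2 else 0)"
      unfolding K_def by linarith
  qed
  then show ?thesis
    by (simp add: mixed_sum_def sum.distrib sum_subtractf)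
qed

text \<open>Reflection contributes \<open>(-1) ^ Suc j\<close>, which turns the alternating weights
  \<open>(-1) ^ j\<close> into a global sign.\<close>

lemma mixed_sum_euler_bar_minus:
  "mixed_sum (\<lambda>j. euler_bar j (- w)) g (-1) m n = - mixed_sum (\<lambda>j. euler_bar j w) g 1 m n"
  unfolding mixed_sum_def sum_negf[symmetric]
  by (intro sum.cong refl) (simp add: euler_bar_minus power_mult_distrib[symmetric] mult_ac)

lemma mixed_sum_scale: "mixed_sum (\<lambda>j. c * f j) g e m n = c * mixed_sum f g e m n"
  unfolding mixed_sum_def by (simp add: sum_distrib_left mult_ac)

text \<open>
  Left minus right side of the theorem for \<open>a = b = 1\<close> and \<open>x = 0\<close>, with the signs
  \<open>(-1)\<^sup>m\<^sup>+\<^sup>n\<close> absorbed by reflecting both Euler functions.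
\<close>

definition bar_defect :: "nat \<Rightarrow> nat \<Rightarrow> real \<Rightarrow> real \<Rightarrow> real" where
  "bar_defect m n y z =
     2 * mixed_sum (\<lambda>j. euler_bar j (z - y)) (\<lambda>j. bernoulli_bar j z) (-1) m n
     + 2 * mixed_sum (\<lambda>j. euler_bar j (y - z)) (\<lambda>j. bernoulli_bar j y) (-1) n m
     - euler_bar m y * euler_bar n z
     - of_bool (m = 0 \<and> n = 0) * int_sign y * int_sign z
     - (-1) ^ m * 2 * fact m * fact n / fact (m + n + 1) * euler_bar (m + n + 1) (z - y)"

text \<open>Only the last term is not visibly symmetric; reflecting its Euler function contributes
  \<open>(-1) ^ (m + n)\<close> and so trades \<open>(-1) ^ m\<close> for
  \<open>(-1) ^ n\<close>.\<close>

lemma bar_defect_swap: "bar_defect m n y z = bar_defect n m z y"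
proof -
  have "(-1) ^ m * euler_bar (m + n + 1) (z - y) = (-1) ^ n * euler_bar (n + m + 1) (y - z)"
    using euler_bar_minus[of "m + n + 1" "y - z"] by (simp add: power_add add.commute)
  then have "(-1) ^ m * 2 * fact m * fact n / fact (m + n + 1) * euler_bar (m + n + 1) (z - y)
    = (-1) ^ n * 2 * fact n * fact m / fact (n + m + 1) * euler_bar (n + m + 1) (y - z)"
    by (simp add: add.commute mult_ac)
  then show ?thesis by (simp add: bar_defect_def mult_ac conj_commute)
qed

lemma bar_defect_add_of_int:
  "bar_defect m n (y + of_int i) (z + of_int k) = (-1) powi (i + k) * bar_defect m n y z"
proof -
  have p: "(-1 :: real) powi (k - i) = (-1) powi (i + k)" "(-1 :: real) powi (i - k) = (-1) powi (i + k)"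
    by (auto simp: power_int_minus_left)
  have 1: "euler_bar j (z + of_int k - (y + of_int i)) = (-1) powi (i + k) * euler_bar j (z - y)" for j
    using euler_bar_add_of_int[of j "z - y" "k - i"] by (simp add: algebra_simps p)
  have 2: "euler_bar j (y + of_int i - (z + of_int k)) = (-1) powi (i + k) * euler_bar j (y - z)" for j
    using euler_bar_add_of_int[of j "y - z" "i - k"] by (simp add: algebra_simps p)
  show ?thesis
    unfolding bar_defect_def 1 2 mixed_sum_scale bernoulli_bar_add_of_int euler_bar_add_of_int int_sign_add_of_int
    by (simp add: algebra_simps power_int_add)
qed

text \<open>The ordering puts \<open>z - y\<close> into the unit interval too, so everything is
  \<open>defect_poly\<close> plus corrections at integer arguments, and these cancel.\<close>

lemma bar_defect_unit:
  assumes "0 \<le> y" "y \<le> z" "z < 1"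
  shows "bar_defect m n y z = 0"
proof -
  let ?w = "z - y"
  have w: "0 \<le> ?w" "?w < 1" using assms by auto
  have z: "0 \<le> z" "y < 1" using assms by auto
  \<comment> \<open>For \<open>?w = 0\<close> the points \<open>y\<close> and \<open>z\<close>
    coincide, so the Euler corrections of the two mixed sums cancel.\<close>
  have b: "of_bool (?w = 0) * bernoulli_bar (m + n + 1) z = of_bool (?w = 0) * bernoulli_bar (m + n + 1) y"
    by simp
  have mw: "y - z = - ?w" by simp
  have r: "((-1) ^ m + 1) * euler_poly m 0 = 2 * of_bool (m = 0)"
    using euler_poly_0_eq_neg[of m] by (cases "m = 0") (auto simp: algebra_simps)
  have "bar_defect m n y z = defect_poly m n y z
     + of_bool (n = 0 \<and> z = 0) * (-1) ^ m * euler_poly m ?w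
     - of_bool (m = 0 \<and> y = 0) * euler_poly n ?w
     + euler_poly m y * euler_poly n z - euler_bar m y * euler_bar n z
     - of_bool (m = 0 \<and> n = 0) * int_sign y * int_sign z"
    unfolding bar_defect_def defect_poly_def mw mixed_sum_euler_bar_minus
      mixed_sum_bar_unit[OF w z(1) assms(3)] mixed_sum_bar_unit[OF w assms(1) z(2)]
    using b w by (simp add: euler_bar_unit add.commute algebra_simps)
  \<comment> \<open>For \<open>y = 0 < z\<close> the corrections cancel against the product of Euler
    values. Only \<open>z = 0\<close>, which forces \<open>y = 0\<close>, leaves something, and only
    if \<open>n = 0\<close>.\<close>
  also have "\<dots> = of_bool (n = 0 \<and> z = 0) * (((-1) ^ m + 1) * euler_poly m 0) - 2 * of_bool (m = 0 \<and> n = 0 \<and> z = 0)"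
    using assms z by (auto simp: defect_poly_eq_0 euler_bar_unit int_sign_unit algebra_simps)
  also have "\<dots> = 0" unfolding r by auto
  finally show ?thesis .
qed

lemma bar_defect_eq_0: "bar_defect m n y z = 0"
proof -
  have "bar_defect m n (frac y) (frac z) = 0"
    using bar_defect_unit[of "frac y" "frac z" m n] bar_defect_unit[of "frac z" "frac y" n m]
      bar_defect_swap[of m n "frac y" "frac z"]
    by (cases "frac y \<le> frac z") (auto simp: frac_lt_1)
  moreover have "y = frac y + of_int \<lfloor>y\<rfloor>" "z = frac z + of_int \<lfloor>z\<rfloor>"
    by (simp_all add: frac_def)
  ultimately show ?thesis
    by (metis bar_defect_add_of_int mult_zero_right)
qed

section \<open>Multiplication formulas for antiperiodic functions\<close>

lemma antiperiodic_add_of_int: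
  fixes h :: "real \<Rightarrow> real"
  assumes "\<And>u. h (u + 1) = - h u"
  shows "h (u + of_int i) = (-1) powi i * h u"
proof (induction i rule: int_induct[of _ 0])
  case base
  show ?case by simp
next
  case (step1 i)
  have "h (u + of_int (i + 1)) = - h (u + of_int i)"
    using assms[of "u + of_int i"] by (simp add: add.assoc)
  then show ?case using step1 by (simp add: power_int_add)
next
  case (step2 i)
  have "h (u + of_int i) = - h (u + of_int (i - 1))"
    using assms[of "u + of_int (i - 1)"] by (simp add: algebra_simps)
  then show ?case using step2 by (simp add: power_int_diff)
qed

text \<open>As functions of \<open>v = q * u\<close> both sides are antiperiodic, since raising
  \<open>v\<close> by 1 shifts \<open>k\<close> by one. It is therefore enough to treat
  \<open>0 <= v < 1\<close>, where all points \<open>u + k / q\<close> lie in the unit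
  interval.\<close>

lemma antiperiodic_mult_extend:
  fixes f g :: "real \<Rightarrow> real"
  assumes q: "odd q"
    and f: "\<And>u. f (u + 1) = - f u" and g: "\<And>u. g (u + 1) = - g u"
    and unit: "\<And>u. 0 \<le> u \<Longrightarrow> real q * u < 1 \<Longrightarrow> (\<Sum>k<q. (-1) ^ k * f (u + real k / real q)) = g (real q * u)"
  shows "(\<Sum>k<q. (-1) ^ k * f (u + real k / real q)) = g (real q * u)"
proof -
  have q0: "q > 0" using q odd_pos by blast
  define h where "h = (\<lambda>v. \<Sum>k<q. (-1) ^ k * f (v / real q + real k / real q))"
  have h: "h (v + 1) = - h v" for v
  proof -
    have "h (v + 1) = (\<Sum>k<q. (-1) ^ k * f (v / real q + real (Suc k) / real q))"
      unfolding h_def by (intro sum.cong refl) (simp add: add_divide_distrib algebra_simps)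
    also have "\<dots> = - h v"
      unfolding h_def using q0
      by (intro sum_alternating_shift[OF q, of "\<lambda>k. f (v / real q + real k / real q)"]) (simp add: f)
    finally show ?thesis .
  qed
  define v where "v = real q * u"
  have v: "v = frac v + of_int \<lfloor>v\<rfloor>" by (simp add: frac_def)
  have "h (frac v) = g (frac v)"
    unfolding h_def using unit[of "frac v / real q"] q0 by (simp add: frac_lt_1)
  then have "h v = g v"
    using antiperiodic_add_of_int[of h, OF h, of "frac v" "\<lfloor>v\<rfloor>"]
      antiperiodic_add_of_int[of g, OF g, of "frac v" "\<lfloor>v\<rfloor>"] v by simp
  then show ?thesis using q0 by (simp add: h_def v_def)
qed

lemma euler_bar_add_1: "euler_bar n (u + 1) = - euler_bar n u"
  using euler_bar_add_of_int[of n u 1] by simp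

lemma int_sign_add_1: "int_sign (u + 1) = - int_sign u"
  using int_sign_add_of_int[of u 1] by simp

lemma add_frac_in_unit:
  assumes "0 \<le> u" "real q * u < 1" "k < q"
  shows "0 \<le> u + real k / real q" "u + real k / real q < 1"
    "u + real k / real q = 0 \<longleftrightarrow> k = 0 \<and> u = 0"
proof -
  have "real k + 1 \<le> real q" using assms(3) by linarith
  then show "u + real k / real q < 1" using assms by (simp add: field_simps)
  show "0 \<le> u + real k / real q" using assms by simp
  show "u + real k / real q = 0 \<longleftrightarrow> k = 0 \<and> u = 0"
    using assms by (auto simp: add_nonneg_eq_0_iff)
qed

lemma euler_bar_mult_nat:
  assumes "odd q"
  shows "real q ^ n * (\<Sum>k<q. (-1) ^ k * euler_bar n (u + real k / real q)) = euler_bar n (real q * u)"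
proof -
  have q0: "q > 0" using assms odd_pos by blast
  have "(\<Sum>k<q. (-1) ^ k * euler_bar n (u + real k / real q)) = euler_bar n (real q * u) / real q ^ n"
  proof (rule antiperiodic_mult_extend[OF assms, where f = "euler_bar n" and g = "\<lambda>v. euler_bar n v / real q ^ n"])
    fix u :: real assume u: "0 \<le> u" "real q * u < 1"
    have "(\<Sum>k<q. (-1) ^ k * euler_bar n (u + real k / real q))
       = (\<Sum>k<q. (-1) ^ k * euler_poly n (u + real k / real q) - (if k = 0 then of_bool (n = 0 \<and> u = 0) else 0))"
      using add_frac_in_unit[OF u] by (intro sum.cong refl) (auto simp: euler_bar_unit)
    also have "\<dots> = (\<Sum>k<q. (-1) ^ k * euler_poly n (u + real k / real q)) - of_bool (n = 0 \<and> u = 0)"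
      using q0 by (simp add: sum_subtractf)
    also have "(\<Sum>k<q. (-1) ^ k * euler_poly n (u + real k / real q)) = euler_poly n (real q * u) / real q ^ n"
      using euler_poly_mult[OF assms, of n u] q0 by (simp add: field_simps)
    \<comment> \<open>The correction is present only for \<open>n = 0\<close>, where
      \<open>q ^ n = 1\<close>, so the division does not affect it.\<close>
    also have "\<dots> - of_bool (n = 0 \<and> u = 0) = euler_bar n (real q * u) / real q ^ n"
      using u q0 by (auto simp: euler_bar_unit)
    finally show "(\<Sum>k<q. (-1) ^ k * euler_bar n (u + real k / real q)) = euler_bar n (real q * u) / real q ^ n" .
  qed (simp_all add: euler_bar_add_1)
  then show ?thesis using q0 by simp
qed

lemma int_sign_mult_nat:
  assumes "odd q"
  shows "(\<Sum>k<q. (-1) ^ k * int_sign (u + real k / real q)) = int_sign (real q * u)"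
proof (rule antiperiodic_mult_extend[OF assms])
  fix u :: real assume u: "0 \<le> u" "real q * u < 1"
  have q0: "q > 0" using assms odd_pos by blast
  have "(\<Sum>k<q. (-1) ^ k * int_sign (u + real k / real q)) = (\<Sum>k<q. if k = 0 then of_bool (u = 0) else 0)"
    using add_frac_in_unit[OF u] by (intro sum.cong refl) (auto simp: int_sign_unit)
  also have "\<dots> = int_sign (real q * u)"
    using u q0 by (auto simp: int_sign_unit)
  finally show "(\<Sum>k<q. (-1) ^ k * int_sign (u + real k / real q)) = int_sign (real q * u)" .
qed (simp_all add: int_sign_add_1)

text \<open>For \<open>a > 0\<close> the points \<open>t - (k + y) / a\<close> run backwards;
  reflection is applied both to them and to the value outside, giving \<open>s * s = 1\<close>. For
  \<open>a < 0\<close> they already run forwards, and only the outer argument is reflected, which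
  leaves one \<open>s\<close>.\<close>

lemma signed_mult_formula:
  fixes f :: "real \<Rightarrow> real" and a :: int and c s :: real
  assumes a: "odd a"
    and mult: "\<And>u. c * (\<Sum>k<nat \<bar>a\<bar>. (-1) ^ k * f (u + real k / real (nat \<bar>a\<bar>))) = f (real (nat \<bar>a\<bar>) * u)"
    and refl: "\<And>w. f (- w) = s * f w" and s: "s * s = 1"
  shows "f (of_int a * t - y) = (if a > 0 then c else s * c) *
           (\<Sum>k<nat \<bar>a\<bar>. (-1) ^ k * f (t - (real k + y) / of_int a))"
proof (cases "a > 0")
  case True
  then have q: "real (nat \<bar>a\<bar>) = of_int a" by simp
  have "f (t - (real k + y) / of_int a) = s * f (y / of_int a - t + real k / real (nat \<bar>a\<bar>))" for k
    using True unfolding q by (subst refl[symmetric]) (simp add: add_divide_distrib algebra_simps)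
  then have "c * (\<Sum>k<nat \<bar>a\<bar>. (-1) ^ k * f (t - (real k + y) / of_int a))
     = s * (c * (\<Sum>k<nat \<bar>a\<bar>. (-1) ^ k * f (y / of_int a - t + real k / real (nat \<bar>a\<bar>))))"
    by (simp only: sum_distrib_left mult_ac)
  also have "\<dots> = s * f (- (of_int a * t - y))"
  proof -
    have "real (nat \<bar>a\<bar>) * (y / of_int a - t) = - (of_int a * t - y)"
      unfolding q using True by (simp add: field_simps)
    then show ?thesis by (simp only: mult)
  qed
  also have "\<dots> = (s * s) * f (of_int a * t - y)"
    by (simp only: refl mult.assoc)
  finally show ?thesis using True s by simp
next
  case False
  with a have neg: "a < 0" by (metis even_zero linorder_neqE_linordered_idom)
  then have q: "real (nat \<bar>a\<bar>) = - of_int a" by simp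
  have "f (t - (real k + y) / of_int a) = f (t - y / of_int a + real k / real (nat \<bar>a\<bar>))" for k
    unfolding q by (simp add: add_divide_distrib algebra_simps)
  then have "s * c * (\<Sum>k<nat \<bar>a\<bar>. (-1) ^ k * f (t - (real k + y) / of_int a))
     = s * (c * (\<Sum>k<nat \<bar>a\<bar>. (-1) ^ k * f (t - y / of_int a + real k / real (nat \<bar>a\<bar>))))"
    by (simp only: mult.assoc)
  also have "\<dots> = s * f (- (of_int a * t - y))"
  proof -
    have "real (nat \<bar>a\<bar>) * (t - y / of_int a) = - (of_int a * t - y)"
      unfolding q using neg by (simp add: field_simps)
    then show ?thesis by (simp only: mult)
  qed
  also have "\<dots> = (s * s) * f (of_int a * t - y)"
    by (simp only: refl mult.assoc)
  finally show ?thesis using False s by simp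
qed

lemma euler_bar_mult:
  assumes "odd a"
  shows "euler_bar n (of_int a * t - y) = sgn (of_int a) * of_int a ^ n *
           (\<Sum>k<nat \<bar>a\<bar>. (-1) ^ k * euler_bar n (t - (real k + y) / of_int a))"
proof -
  have odd: "odd (nat \<bar>a\<bar>)" using assms by (simp add: even_nat_iff)
  \<comment> \<open>For \<open>a < 0\<close> the factor is
    \<open>(-1) ^ (n + 1) * |a| ^ n = - a ^ n\<close>.\<close>
  have "(if a > 0 then real (nat \<bar>a\<bar>) ^ n else (-1) ^ Suc n * real (nat \<bar>a\<bar>) ^ n) = sgn (of_int a) * of_int a ^ n"
    using assms by (cases a "0 :: int" rule: linorder_cases) (auto simp: power_mult_distrib[symmetric])
  moreover have "(-1) ^ Suc n * (-1) ^ Suc n = (1 :: real)"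
    by (simp add: power_mult_distrib[symmetric])
  ultimately show ?thesis
    using signed_mult_formula[OF assms euler_bar_mult_nat[OF odd] euler_bar_minus, of n t y] by simp
qed

lemma int_sign_mult_formula:
  assumes "odd a"
  shows "int_sign (of_int a * t - y) = (\<Sum>k<nat \<bar>a\<bar>. (-1) ^ k * int_sign (t - (real k + y) / of_int a))"
proof -
  have odd: "odd (nat \<bar>a\<bar>)" using assms by (simp add: even_nat_iff)
  show ?thesis
    using signed_mult_formula[OF assms, of 1 int_sign 1 t y] int_sign_mult_nat[OF odd]
    by (simp add: int_sign_minus)
qed

section \<open>The alternating Euler sum and the gcd\<close>

lemma sum_periodic_group:
  fixes p :: "nat \<Rightarrow> real"
  assumes "\<And>r. p (r + q) = p r"
  shows "(\<Sum>r<g * q. p r) = real g * (\<Sum>r<q. p r)"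
proof -
  have per: "p (r + i * q) = p r" for r i
    by (induction i) (simp_all add: assms add.assoc[symmetric] add.commute[of q])
  have "(\<Sum>r=i * q..<i * q + q. p r) = (\<Sum>r<q. p r)" for i
    using sum.shift_bounds_nat_ivl[of p 0 "i * q" q] by (simp add: per add.commute atLeast0LessThan)
  then show ?thesis
    by (simp flip: sum.nat_group)
qed

text \<open>Multiplication by a unit permutes the residues modulo \<open>q\<close>.\<close>

lemma sum_periodic_coprime_reindex:
  fixes h :: "int \<Rightarrow> real" and c :: int
  assumes per: "\<And>k i. h (k + i * int q) = h k" and c: "coprime c (int q)" and q: "q > 0"
  shows "(\<Sum>r<q. h (c * int r)) = (\<Sum>k<q. h (int k))"
proof -
  define \<phi> where "\<phi> = (\<lambda>r. nat ((c * int r) mod int q))"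
  have h: "h (c * int r) = h (int (\<phi> r))" for r
  proof -
    have "c * int r = int (\<phi> r) + (c * int r div int q) * int q"
      using q by (simp add: \<phi>_def)
    then show ?thesis by (metis per)
  qed
  have inj: "inj_on \<phi> {..<q}"
  proof (rule inj_onI)
    fix r r' assume r: "r \<in> {..<q}" "r' \<in> {..<q}" and eq: "\<phi> r = \<phi> r'"
    then have "(c * int r) mod int q = (c * int r') mod int q"
      using q by (simp add: \<phi>_def nat_eq_iff)
    then have "int q dvd c * (int r - int r')"
      by (simp add: mod_eq_dvd_iff right_diff_distrib)
    then have "int q dvd int r - int r'"
      using c by (simp add: coprime_dvd_mult_right_iff coprime_commute)
    then show "r = r'"
      using r zdvd_imp_le[of "int q" "\<bar>int r - int r'\<bar>"] by (cases "r = r'") auto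
  qed
  moreover have "\<phi> ` {..<q} \<subseteq> {..<q}"
    using q by (auto simp: \<phi>_def nat_less_iff)
  ultimately have "\<phi> ` {..<q} = {..<q}"
    by (intro endo_inj_surj) auto
  then show ?thesis
    unfolding h using sum.reindex[OF inj, of "\<lambda>k. h (int k)"] by simp
qed

text \<open>With \<open>a = g a'\<close> and \<open>b = g b'\<close>, the summand depends only on
  \<open>- a' r\<close> modulo \<open>b'\<close>. The sum thus consists of \<open>g\<close> full
  periods; each can be reindexed by the unit \<open>- a'\<close> and evaluated by the multiplication
  formula for \<open>b'\<close>. The periods give one factor \<open>g\<close>, and
  \<open>b' ^ n = b ^ n / g ^ n\<close> gives the others.\<close>

lemma sum_euler_bar_gcd:
  assumes "odd a" "odd b"
  shows "(\<Sum>r<nat \<bar>b\<bar>. (-1) ^ r * euler_bar n (of_int a * ((real r + z) / of_int b) - y))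
    = sgn (of_int b) * of_int (gcd a b) ^ (n + 1) / of_int b ^ n
       * euler_bar n ((of_int a * z - of_int b * y) / of_int (gcd a b))"
proof -
  define g where "g = gcd a b"
  define a' where "a' = a div g"
  define b' where "b' = b div g"
  have b0: "b \<noteq> 0" using assms by auto
  have g: "g > 0" using b0 by (simp add: g_def)
  have ab: "a = g * a'" "b = g * b'" by (simp_all add: a'_def b'_def g_def)
  have odd': "odd a'" "odd b'" using assms ab by auto
  have b'0: "b' \<noteq> 0" using odd' by auto
  have cop: "coprime a' b'"
    unfolding a'_def b'_def g_def using b0 by (intro div_gcd_coprime) auto
  define q where "q = nat \<bar>b'\<bar>"
  have q: "q > 0" using b'0 by (simp add: q_def)
  define v where "v = of_int a' * z / of_int b' - y"
  \<comment> \<open>The sign makes \<open>h\<close> periodic: a shift of \<open>k\<close> by the odd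
    number \<open>b'\<close> changes both factors by -1.\<close>
  define h where "h = (\<lambda>k :: int. (-1) powi k * euler_bar n (v - of_int k / of_int b'))"
  have per1: "h (k + i * b') = h k" for k i
  proof -
    have "v - of_int (k + i * b') / of_int b' = v - of_int k / of_int b' + of_int (- i)"
      using b'0 by (simp add: field_simps)
    then have "h (k + i * b') = (-1) powi (k + i * b') * ((-1) powi (- i) * euler_bar n (v - of_int k / of_int b'))"
      unfolding h_def by (simp only: euler_bar_add_of_int)
    moreover have "(-1 :: real) powi (k + i * b') * (-1) powi (- i) = (-1) powi k"
      using odd' by (auto simp: power_int_minus_left)
    ultimately show ?thesis by (simp add: h_def mult.assoc[symmetric])
  qed
  have per: "h (k + i * int q) = h k" for k i
    using per1[of k i] per1[of k "- i"] b'0 by (cases "b' > 0") (simp_all add: q_def)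
  have smd: "(-1) ^ r * euler_bar n (of_int a * ((real r + z) / of_int b) - y) = h ((- a') * int r)" for r
  proof -
    have "of_int a * ((real r + z) / of_int b) - y = v - of_int ((- a') * int r) / of_int b'"
      using g b'0 by (simp add: ab v_def field_simps)
    moreover have "(-1 :: real) ^ r = (-1) powi ((- a') * int r)"
      using odd' by (simp add: power_int_minus_left)
    ultimately show ?thesis by (simp only: h_def)
  qed
  have "(\<Sum>r<nat \<bar>b\<bar>. (-1) ^ r * euler_bar n (of_int a * ((real r + z) / of_int b) - y))
      = (\<Sum>r<nat g * q. h ((- a') * int r))"
    unfolding smd using g by (simp add: ab q_def abs_mult nat_mult_distrib)
  also have "\<dots> = real (nat g) * (\<Sum>r<q. h ((- a') * int r))"
  proof (rule sum_periodic_group)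
    show "h ((- a') * int (r + q)) = h ((- a') * int r)" for r
      using per[of "(- a') * int r" "- a'"] by (simp add: algebra_simps)
  qed
  also have "(\<Sum>r<q. h ((- a') * int r)) = (\<Sum>k<q. h (int k))"
    using cop q per by (intro sum_periodic_coprime_reindex) (auto simp: q_def)
  also have "\<dots> = (\<Sum>k<nat \<bar>b'\<bar>. (-1) ^ k * euler_bar n (v - (real k + 0) / of_int b'))"
    by (simp add: h_def q_def)
  \<comment> \<open>The multiplication formula for \<open>b'\<close>, with shift 0, read from right
    to left.\<close>
  also have "\<dots> = sgn (of_int b') / of_int b' ^ n * euler_bar n (of_int b' * v - 0)"
    unfolding euler_bar_mult[OF odd'(2)] using b'0 by (simp add: sgn_if)
  also have "of_int b' * v - 0 = (of_int a * z - of_int b * y) / of_int g"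
    using g b'0 by (simp add: ab v_def field_simps)
  also have "sgn (of_int b' :: real) = sgn (of_int b)"
    using g by (simp add: ab sgn_mult)
  also have "of_int b' ^ n = (of_int b ^ n / of_int g ^ n :: real)"
    using g by (simp add: ab power_mult_distrib)
  finally show ?thesis using g by (simp add: g_def mult_ac)
qed

section \<open>Reduction of general odd coefficients to coefficients one\<close>

text \<open>Expanding \<open>euler_bar j\<close> by the multiplication formula yields
  \<open>a ^ j\<close>, which completes \<open>a ^ (m - j)\<close> to \<open>a ^ m\<close>. The
  weights become free of \<open>a\<close>, and the sum over \<open>j\<close> moves inside. The two
  copies of \<open>x\<close> in the Euler argument cancel; they give it the form required by
  \<open>bar_defect\<close>.\<close>

lemma S5_sum_expand:
  assumes "odd a"
  shows "(\<Sum>j=0..m. real (m choose j) * (-1) ^ j * of_int a ^ (m - j) / real (m + n + 1 - j)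
            * S5 j (m + n + 1 - j) a 1 b y x z)
    = sgn (of_int a) * of_int a ^ m * (\<Sum>r<nat \<bar>b\<bar>. \<Sum>k<nat \<bar>a\<bar>. (-1) ^ r * (-1) ^ k *
        mixed_sum (\<lambda>j. euler_bar j (((real r + z) / of_int b - x) - ((real k + y) / of_int a - x)))
                  (\<lambda>j. bernoulli_bar j ((real r + z) / of_int b - x)) (-1) m n)"
proof -
  define E where "E = (\<lambda>j r k. euler_bar j ((real r + z) / of_int b - (real k + y) / of_int a))"
  define B where "B = (\<lambda>j r. bernoulli_bar j ((real r + z) / of_int b - x))"
  have S: "S5 j N a 1 b y x z = sgn (of_int a) * of_int a ^ j *
      (\<Sum>r<nat \<bar>b\<bar>. \<Sum>k<nat \<bar>a\<bar>. (-1) ^ r * (-1) ^ k * (E j r k * B N r))" for j N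
    unfolding S5_def sum_distrib_left
  proof (intro sum.cong refl)
    fix r
    have "of_int a * (real r + z) / of_int b - y = of_int a * ((real r + z) / of_int b) - y" by simp
    then have "euler_bar j (of_int a * (real r + z) / of_int b - y)
        = sgn (of_int a) * of_int a ^ j * (\<Sum>k<nat \<bar>a\<bar>. (-1) ^ k * E j r k)"
      by (simp only: euler_bar_mult[OF assms] E_def)
    then show "(-1) ^ r * euler_bar j (of_int a * (real r + z) / of_int b - y) *
        bernoulli_bar N (of_int 1 * (real r + z) / of_int b - x) =
       (\<Sum>k<nat \<bar>a\<bar>. sgn (of_int a) * of_int a ^ j * ((-1) ^ r * (-1) ^ k * (E j r k * B N r)))"
      by (simp add: B_def sum_distrib_left sum_distrib_right mult_ac)
  qed
  have "(\<Sum>j=0..m. real (m choose j) * (-1) ^ j * of_int a ^ (m - j) / real (m + n + 1 - j)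
            * S5 j (m + n + 1 - j) a 1 b y x z)
     = (\<Sum>j\<le>m. \<Sum>r<nat \<bar>b\<bar>. \<Sum>k<nat \<bar>a\<bar>. sgn (of_int a) * of_int a ^ m * ((-1) ^ r * (-1) ^ k *
          (real (m choose j) * (-1) ^ j / real (m + n + 1 - j) * E j r k * B (m + n + 1 - j) r)))"
    unfolding S sum_distrib_left atLeast0AtMost
  proof (intro sum.cong refl)
    fix j r k assume "j \<in> {..m}"
    then have "(of_int a :: real) ^ m = of_int a ^ (m - j) * of_int a ^ j"
      by (simp flip: power_add)
    then show "real (m choose j) * (-1) ^ j * of_int a ^ (m - j) / real (m + n + 1 - j) *
        (sgn (of_int a) * of_int a ^ j * ((-1) ^ r * (-1) ^ k * (E j r k * B (m + n + 1 - j) r)))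
      = sgn (of_int a) * of_int a ^ m * ((-1) ^ r * (-1) ^ k *
          (real (m choose j) * (-1) ^ j / real (m + n + 1 - j) * E j r k * B (m + n + 1 - j) r))"
      by (simp only: mult_ac times_divide_eq_left times_divide_eq_right)
  qed
  also have "\<dots> = (\<Sum>r<nat \<bar>b\<bar>. \<Sum>k<nat \<bar>a\<bar>. \<Sum>j\<le>m. sgn (of_int a) * of_int a ^ m * ((-1) ^ r * (-1) ^ k *
          (real (m choose j) * (-1) ^ j / real (m + n + 1 - j) * E j r k * B (m + n + 1 - j) r)))"
    by (rule trans[OF sum.swap]) (intro sum.cong refl sum.swap)
  finally show ?thesis
    unfolding mixed_sum_def sum_distrib_left by (simp add: E_def B_def)
qed

theorem theorem1p1:
  fixes m n :: nat and a b :: int and x y z :: real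
  assumes "odd a" and "odd b"
  shows "2 * of_int b ^ n * sgn (of_int b) *
           (\<Sum>j=0..m. real (m choose j) * (-1) ^ j * of_int a ^ (m - j) / real (m + n + 1 - j)
                        * S5 j (m + n + 1 - j) a 1 b y x z)
       + 2 * of_int a ^ m * sgn (of_int a) *
           (\<Sum>j=0..n. real (n choose j) * (-1) ^ j * of_int b ^ (n - j) / real (m + n + 1 - j)
                        * S5 j (m + n + 1 - j) b 1 a z x y)
       = (-1) ^ (m + n) * euler_bar m (of_int a * x - y) * euler_bar n (of_int b * x - z)
       + of_bool (m = 0) * of_bool (n = 0) * sgn (of_int (a * b))
           * (-1) powi \<lfloor>of_int a * x + of_int b * x - y - z\<rfloor>
           * delta_Z (of_int a * x - y) * delta_Z (of_int b * x - z)
       + (-1) ^ m * 2 * fact m * fact n * of_int (gcd a b) ^ (m + n + 2)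
           / (of_int a ^ (n + 1) * of_int b ^ (m + 1) * fact (m + n + 1))
           * euler_bar (m + n + 1) ((of_int a * z - of_int b * y) / of_int (gcd a b))"
proof -
  define Y where "Y = (\<lambda>k. (real k + y) / of_int a - x)"
  define Z where "Z = (\<lambda>r. (real r + z) / of_int b - x)"
  define \<Sigma> where "\<Sigma> = (\<lambda>F. \<Sum>r<nat \<bar>b\<bar>. \<Sum>k<nat \<bar>a\<bar>. (-1) ^ r * (-1) ^ k * F (Y k) (Z r) :: real)"
  \<comment> \<open>Every term of the theorem becomes \<open>c\<close> times an alternating double
    sum \<open>\<Sigma>\<close> of the corresponding term for coefficients one.\<close>
  define c :: real where "c = sgn (of_int a) * sgn (of_int b) * of_int a ^ m * of_int b ^ n"
  define \<kappa> :: real where "\<kappa> = (-1) ^ m * 2 * fact m * fact n / fact (m + n + 1)"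
  have nz: "a \<noteq> 0" "b \<noteq> 0" using assms by auto
  define M1 where "M1 = (\<lambda>y z. mixed_sum (\<lambda>j. euler_bar j (z - y)) (\<lambda>j. bernoulli_bar j z) (-1) m n)"
  define M2 where "M2 = (\<lambda>y z. mixed_sum (\<lambda>j. euler_bar j (y - z)) (\<lambda>j. bernoulli_bar j y) (-1) n m)"
  define I where "I = (\<lambda>y z. of_bool (m = 0 \<and> n = 0) * (int_sign y * int_sign z))"
  have "2 * M1 y z + 2 * M2 y z = euler_bar m y * euler_bar n z + I y z + \<kappa> * euler_bar (m + n + 1) (z - y)" for y z
    using bar_defect_eq_0[of m n y z] unfolding bar_defect_def M1_def M2_def I_def \<kappa>_def
    by (simp add: mult.assoc)
  then have "\<Sigma> (\<lambda>y z. 2 * M1 y z + 2 * M2 y z)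
      = \<Sigma> (\<lambda>y z. euler_bar m y * euler_bar n z + I y z + \<kappa> * euler_bar (m + n + 1) (z - y))"
    by simp
  then have core: "2 * \<Sigma> M1 + 2 * \<Sigma> M2 = \<Sigma> (\<lambda>y z. euler_bar m y * euler_bar n z) + \<Sigma> I
      + \<kappa> * \<Sigma> (\<lambda>y z. euler_bar (m + n + 1) (z - y))"
    unfolding \<Sigma>_def by (simp add: sum_distrib_left distrib_left sum.distrib mult_ac)
  have L1: "2 * of_int b ^ n * sgn (of_int b) *
           (\<Sum>j=0..m. real (m choose j) * (-1) ^ j * of_int a ^ (m - j) / real (m + n + 1 - j)
                        * S5 j (m + n + 1 - j) a 1 b y x z) = c * (2 * \<Sigma> M1)"
    unfolding S5_sum_expand[OF assms(1)] c_def \<Sigma>_def M1_def Y_def Z_def by (simp only: mult_ac)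
  have L2: "2 * of_int a ^ m * sgn (of_int a) *
           (\<Sum>j=0..n. real (n choose j) * (-1) ^ j * of_int b ^ (n - j) / real (m + n + 1 - j)
                        * S5 j (m + n + 1 - j) b 1 a z x y) = c * (2 * \<Sigma> M2)"
  proof -
    have "\<Sigma> M2 = (\<Sum>k<nat \<bar>a\<bar>. \<Sum>r<nat \<bar>b\<bar>. (-1) ^ k * (-1) ^ r * M2 (Y k) (Z r))"
      unfolding \<Sigma>_def by (rule trans[OF sum.swap]) (simp only: mult_ac)
    then show ?thesis
      unfolding add.commute[of m n] S5_sum_expand[OF assms(2)] c_def M2_def Y_def Z_def by (simp only: mult_ac)
  qed
  \<comment> \<open>Reflection replaces \<open>x - (k + y) / a\<close> by \<open>Y k\<close>;
    together with \<open>En\<close> it accounts for the sign \<open>(-1) ^ (m + n)\<close>.\<close>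
  have Em: "euler_bar m (of_int a * x - y) = sgn (of_int a) * of_int a ^ m * (-1) ^ Suc m * (\<Sum>k<nat \<bar>a\<bar>. (-1) ^ k * euler_bar m (Y k))"
  proof -
    have "euler_bar m (x - (real k + y) / of_int a) = (-1) ^ Suc m * euler_bar m (Y k)" for k
      unfolding Y_def by (subst euler_bar_minus[symmetric]) simp
    then show ?thesis unfolding euler_bar_mult[OF assms(1)] by (simp add: sum_distrib_left mult_ac)
  qed
  have En: "euler_bar n (of_int b * x - z) = sgn (of_int b) * of_int b ^ n * (-1) ^ Suc n * (\<Sum>r<nat \<bar>b\<bar>. (-1) ^ r * euler_bar n (Z r))"
  proof -
    have "euler_bar n (x - (real r + z) / of_int b) = (-1) ^ Suc n * euler_bar n (Z r)" for r
      unfolding Z_def by (subst euler_bar_minus[symmetric]) simp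
    then show ?thesis unfolding euler_bar_mult[OF assms(2)] by (simp add: sum_distrib_left mult_ac)
  qed
  have prod: "\<Sigma> (\<lambda>y z. f y * g z) = (\<Sum>k<nat \<bar>a\<bar>. (-1) ^ k * f (Y k)) * (\<Sum>r<nat \<bar>b\<bar>. (-1) ^ r * g (Z r))" for f g
    unfolding \<Sigma>_def sum_product by (rule trans[OF sum.swap]) (simp only: mult_ac)
  have R1: "(-1) ^ (m + n) * euler_bar m (of_int a * x - y) * euler_bar n (of_int b * x - z)
      = c * \<Sigma> (\<lambda>y z. euler_bar m y * euler_bar n z)"
  proof -
    have "(-1) ^ (m + n) * (-1) ^ Suc m * (-1) ^ Suc n = (1 :: real)"
      by (simp add: power_add mult_ac flip: power_mult_distrib)
    then have "c * \<Sigma> (\<lambda>y z. euler_bar m y * euler_bar n z)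
        = (-1) ^ (m + n) * (-1) ^ Suc m * (-1) ^ Suc n * (c * \<Sigma> (\<lambda>y z. euler_bar m y * euler_bar n z))"
      by (simp only: mult_1_left)
    then show ?thesis unfolding prod Em En c_def by (simp only: mult_ac)
  qed
  have R2: "of_bool (m = 0) * of_bool (n = 0) * sgn (of_int (a * b))
           * (-1) powi \<lfloor>of_int a * x + of_int b * x - y - z\<rfloor>
           * delta_Z (of_int a * x - y) * delta_Z (of_int b * x - z) = c * \<Sigma> I"
  proof (cases "m = 0 \<and> n = 0")
    case True
    have i: "int_sign (x - u) = int_sign (u - x)" for u
      using int_sign_minus[of "x - u"] by simp
    have fl: "of_int a * x + of_int b * x - y - z = (of_int a * x - y) + (of_int b * x - z)" by simp
    have "int_sign (of_int a * x - y) * int_sign (of_int b * x - z) = \<Sigma> (\<lambda>y z. int_sign y * int_sign z)"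
      unfolding prod int_sign_mult_formula[OF assms(1)] int_sign_mult_formula[OF assms(2)] Y_def Z_def i ..
    then show ?thesis
      using True int_sign_mult[of "of_int a * x - y" "of_int b * x - z"]
      unfolding fl I_def by (simp add: c_def sgn_mult mult.assoc)
  qed (auto simp: I_def \<Sigma>_def)
  have R3: "(-1) ^ m * 2 * fact m * fact n * of_int (gcd a b) ^ (m + n + 2)
           / (of_int a ^ (n + 1) * of_int b ^ (m + 1) * fact (m + n + 1))
           * euler_bar (m + n + 1) ((of_int a * z - of_int b * y) / of_int (gcd a b))
      = c * (\<kappa> * \<Sigma> (\<lambda>y z. euler_bar (m + n + 1) (z - y)))"
  proof -
    let ?N = "m + n + 1"
    let ?G = "euler_bar ?N ((of_int a * z - of_int b * y) / of_int (gcd a b))"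
    \<comment> \<open>The multiplication formula collapses the sum over \<open>k\<close>; the
      remaining sum over \<open>r\<close> is the one that contains the gcd.\<close>
    have 1: "(\<Sum>k<nat \<bar>a\<bar>. (-1) ^ k * euler_bar ?N (Z r - Y k))
        = sgn (of_int a) / of_int a ^ ?N * euler_bar ?N (of_int a * ((real r + z) / of_int b) - y)" for r
      unfolding euler_bar_mult[OF assms(1)] Y_def Z_def using nz by (simp add: sgn_if)
    have "\<Sigma> (\<lambda>y z. euler_bar ?N (z - y))
       = (\<Sum>r<nat \<bar>b\<bar>. (-1) ^ r * (\<Sum>k<nat \<bar>a\<bar>. (-1) ^ k * euler_bar ?N (Z r - Y k)))"
      unfolding \<Sigma>_def by (simp add: sum_distrib_left mult.assoc)
    also have "\<dots> = sgn (of_int a) / of_int a ^ ?N *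
        (\<Sum>r<nat \<bar>b\<bar>. (-1) ^ r * euler_bar ?N (of_int a * ((real r + z) / of_int b) - y))"
      unfolding 1 by (simp add: sum_distrib_left mult_ac)
    also have "\<dots> = sgn (of_int a) / of_int a ^ ?N *
        (sgn (of_int b) * of_int (gcd a b) ^ (?N + 1) / of_int b ^ ?N * ?G)"
      by (simp only: sum_euler_bar_gcd[OF assms])
    finally have S: "\<Sigma> (\<lambda>y z. euler_bar ?N (z - y)) = \<dots>" .
    have "sgn (real_of_int a) * sgn (of_int a) = 1" "sgn (real_of_int b) * sgn (of_int b) = 1"
      using nz by (simp_all add: sgn_if)
    \<comment> \<open>The signs square to 1, and of the powers \<open>a ^ m / a ^ ?N\<close> and
      \<open>b ^ n / b ^ ?N\<close> only the denominators \<open>a ^ (n + 1)\<close> and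
      \<open>b ^ (m + 1)\<close> remain.\<close>
    then have cS: "c * (sgn (of_int a) / of_int a ^ ?N * (sgn (of_int b) * of_int (gcd a b) ^ (?N + 1) / of_int b ^ ?N * ?G))
        = of_int (gcd a b) ^ (?N + 1) / (of_int a ^ (n + 1) * of_int b ^ (m + 1)) * ?G"
      unfolding c_def using nz by (simp add: power_add field_simps sgn_if)
    have "c * (\<kappa> * \<Sigma> (\<lambda>y z. euler_bar ?N (z - y))) = \<kappa> * (c * \<Sigma> (\<lambda>y z. euler_bar ?N (z - y)))"
      by (rule mult.left_commute)
    also have "\<dots> = \<kappa> * (of_int (gcd a b) ^ (m + n + 2) / (of_int a ^ (n + 1) * of_int b ^ (m + 1)) * ?G)"
      unfolding S cS by simp
    finally show ?thesis
      unfolding \<kappa>_def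
      by (simp only: mult_ac times_divide_eq_left times_divide_eq_right divide_divide_eq_left)
  qed
  show ?thesis
    unfolding L1 L2 R1 R2 R3 using arg_cong[OF core, of "\<lambda>t. c * t"] by (simp only: distrib_left)
qed

end
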